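(* Let $G$ be a finite simple graph with vertices $v_1,\ldots,v_n$, let $L$ be a list of $G$ and let $w$ be a weight of $G$ such that $G$ is $(L,w)$-colorable. Then $$\mathcal{C}(G,L,w)=\bigcup_{\substack{\vec{w}'\in\overrightarrow{W}_{max}(G,L)\\ \vec{w}'\geq\vec{w}}}\ \bigcup_{C'\in\mathcal{C}(G,L,w')_{max}}\mathcal{C}^-(C',\vec{w}'-\vec{w}),$$ where for $\vec w'\in\mathbb N^n$, $w'$ denotes the weight with $w'(v_i)$ equal to the $i$-th coordinate of $\vec w'$.
   Context: A list of $G$ is a map $L$ assigning to each vertex $v$ a finite set $L(v)\subset\mathbb{N}$; $\overline{L}=\bigcup_{v}L(v)$. A weight is a map $w:V(G)\to\mathbb{N}$, with weight-vector $\vec w=\sum_i w(v_i)\vec e_i\in\mathbb N^n$. An $(L,w)$-coloring of $G$ is a map $C$ with $C(v)\subset L(v)$, $|C(v)|=w(v)$ for all $v$, and $C(v)\cap C(v')=\emptyset$ for every edge $vv'$; $\mathcal{C}(G,L,w)$ is the set of all $(L,w)$-colorings. For any map $C$ assigning finite sets to vertices, $\vec{w}(C)=\sum_i|C(v_i)|\vec e_i$. For a color $x$, $C^x(v)=\{x\}$ if $x\in C(v)$ and $\emptyset$ otherwise. For $N\subset V(G)$, $\vec N=\sum_i\lambda_i\vec e_i$ with $\lambda_i=1$ if $v_i\in N$ and $0$ otherwise. On $\mathbb N^n$, $\vec y\le\vec x$ means $y_i\le x_i$ for all $i$. For a color $x$, $G^x$ is the subgraph of $G$ induced by the vertices $v$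 with $x\in L(v)$. For a subgraph $H$ of $G$, $\overrightarrow{MIS}(H)=\{\vec N\in\mathbb N^n : N$ is a maximal (with respect to inclusion) independent set of $H\}$. $\overrightarrow{W}_{max}(G,L)=\sum_{x\in\overline L}\overrightarrow{MIS}(G^x)$ (vectorial sum of sets: all sums $\sum_x \vec z_x$ with $\vec z_x\in\overrightarrow{MIS}(G^x)$). $\mathcal{C}(G,L,w)_{max}=\{C\in\mathcal C(G,L,w): \vec w(C^x)\in\overrightarrow{MIS}(G^x)$ for all $x\in\overline L\}$. For a coloring $C$ and $\vec d\in\mathbb N^n$, $\mathcal C^-(C,\vec d)$ is the set of maps $C'$ with $C'(v)\subset C(v)$ for all $v$ and $\vec w(C')=\vec w(C)-\vec d$. *)

theory Defs
  imports
    "HOL-Library.FuncSet"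
    "Graph_Theory.Graph_Theory"
    "Jordan_Normal_Form.Matrix"
begin

text \<open>
  A finite simple graph is a \<^locale>\<open>graph\<close> (finite, loop-free, no parallel arcs, symmetric),
  where the arcs from u to v and from v to u together stand for the edge uv.
  The enumeration of its vertices is a distinct list \<open>vs\<close>, so that the (i+1)-st vertex is
  \<open>vs ! i\<close>, n is \<open>length vs\<close>, and vectors are elements of \<open>carrier_vec (length vs)\<close>.
  Maps on the vertices that occur as elements of a set (colorings and their sub-maps) are
  \<^const>\<open>extensional\<close> on the vertex set, so that equality of such maps is equality on the vertices.
\<close>

definition is_list :: "('a, 'b) pre_digraph \<Rightarrow> ('a \<Rightarrow> nat set) \<Rightarrow> bool" where
  "is_list G L \<longleftrightarrow> (\<forall>v \<in> verts G. finite (L v))"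

definition all_colors :: "('a, 'b) pre_digraph \<Rightarrow> ('a \<Rightarrow> nat set) \<Rightarrow> nat set" where
  "all_colors G L = (\<Union>v \<in> verts G. L v)"

definition colorings ::
  "('a, 'b) pre_digraph \<Rightarrow> ('a \<Rightarrow> nat set) \<Rightarrow> ('a \<Rightarrow> nat) \<Rightarrow> ('a \<Rightarrow> nat set) set" where
  "colorings G L w =
     {C \<in> extensional (verts G).
        (\<forall>v \<in> verts G. C v \<subseteq> L v \<and> card (C v) = w v) \<and>
        (\<forall>v \<in> verts G. \<forall>v' \<in> verts G. v \<rightarrow>\<^bsub>G\<^esub> v' \<longrightarrow> C v \<inter> C v' = {})}"

definition colorable ::
  "('a, 'b) pre_digraph \<Rightarrow> ('a \<Rightarrow> nat set) \<Rightarrow> ('a \<Rightarrow> nat) \<Rightarrow> bool" where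
  "colorable G L w \<longleftrightarrow> (\<exists>C. C \<in> colorings G L w)"

definition weight_vec :: "'a list \<Rightarrow> ('a \<Rightarrow> nat) \<Rightarrow> nat vec" where
  "weight_vec vs w = vec (length vs) (\<lambda>i. w (vs ! i))"

definition vec_weight :: "'a list \<Rightarrow> nat vec \<Rightarrow> 'a \<Rightarrow> nat" where
  "vec_weight vs x = (\<lambda>v. x $ (THE i. i < length vs \<and> vs ! i = v))"

definition card_vec :: "'a list \<Rightarrow> ('a \<Rightarrow> nat set) \<Rightarrow> nat vec" where
  "card_vec vs C = vec (length vs) (\<lambda>i. card (C (vs ! i)))"

definition color_part ::
  "('a, 'b) pre_digraph \<Rightarrow> ('a \<Rightarrow> nat set) \<Rightarrow> nat \<Rightarrow> 'a \<Rightarrow> nat set" where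
  "color_part G C x = (\<lambda>v \<in> verts G. if x \<in> C v then {x} else {})"

definition char_vec :: "'a list \<Rightarrow> 'a set \<Rightarrow> nat vec" where
  "char_vec vs N = vec (length vs) (\<lambda>i. if vs ! i \<in> N then 1 else 0)"

definition color_subgraph ::
  "('a, 'b) pre_digraph \<Rightarrow> ('a \<Rightarrow> nat set) \<Rightarrow> nat \<Rightarrow> ('a, 'b) pre_digraph" where
  "color_subgraph G L x = G \<restriction> {v \<in> verts G. x \<in> L v}"

definition independent_set :: "('a, 'b) pre_digraph \<Rightarrow> 'a set \<Rightarrow> bool" where
  "independent_set H N \<longleftrightarrow> N \<subseteq> verts H \<and> (\<forall>u \<in> N. \<forall>v \<in> N. \<not> u \<rightarrow>\<^bsub>H\<^esub> v)"

definition maximal_independent_set :: "('a, 'b) pre_digraph \<Rightarrow> 'a set \<Rightarrow> bool" where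
  "maximal_independent_set H N \<longleftrightarrow>
     independent_set H N \<and> (\<forall>N'. independent_set H N' \<and> N \<subseteq> N' \<longrightarrow> N' = N)"

definition MIS_vec :: "'a list \<Rightarrow> ('a, 'b) pre_digraph \<Rightarrow> nat vec set" where
  "MIS_vec vs H = {char_vec vs N | N. maximal_independent_set H N}"

definition W_max ::
  "'a list \<Rightarrow> ('a, 'b) pre_digraph \<Rightarrow> ('a \<Rightarrow> nat set) \<Rightarrow> nat vec set" where
  "W_max vs G L =
     {finsum_vec TYPE(nat) (length vs) z (all_colors G L) | z.
        \<forall>x \<in> all_colors G L. z x \<in> MIS_vec vs (color_subgraph G L x)}"

definition max_colorings ::
  "'a list \<Rightarrow> ('a, 'b) pre_digraph \<Rightarrow> ('a \<Rightarrow> nat set) \<Rightarrow> ('a \<Rightarrow> nat) \<Rightarrow> ('a \<Rightarrow> nat set) set" where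
  "max_colorings vs G L w =
     {C \<in> colorings G L w.
        \<forall>x \<in> all_colors G L.
          card_vec vs (color_part G C x) \<in> MIS_vec vs (color_subgraph G L x)}"

text \<open>
  The condition on the cardinality vector of \<open>C'\<close> is written additively because subtraction
  on \<^typ>\<open>nat\<close> is truncated.
\<close>

definition sub_colorings ::
  "'a list \<Rightarrow> ('a, 'b) pre_digraph \<Rightarrow> ('a \<Rightarrow> nat set) \<Rightarrow> nat vec \<Rightarrow> ('a \<Rightarrow> nat set) set" where
  "sub_colorings vs G C d =
     {C' \<in> extensional (verts G).
        (\<forall>v \<in> verts G. C' v \<subseteq> C v) \<and> card_vec vs C' + d = card_vec vs C}"

end

theory Submission
  imports Defs
begin

text \<open>
  A coloring amounts to one independent set of \<open>G\<^sup>x\<close> per color \<open>x\<close>, namely the set of vertices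
  receiving \<open>x\<close>. Enlarging each of these to a maximal independent set yields a maximal coloring
  whose weight vector lies in \<^const>\<open>W_max\<close> and from which the given one arises by removing colors;
  conversely, removing colors from a coloring keeps it proper.
\<close>

text \<open>A finite graph has only finitely many independent sets, so among those containing
  \<open>N\<close> one is maximal under inclusion.\<close>

lemma independent_set_extend_maximal:
  assumes "finite (verts H)" and "independent_set H N"
  obtains M where "maximal_independent_set H M" and "N \<subseteq> M"
proof -
  have "{N. independent_set H N} \<subseteq> Pow (verts H)"
    by (auto simp: independent_set_def)
  then have "finite {N. independent_set H N}"
    using assms(1) by (meson finite_Pow_iff finite_subset)
  from finite_has_maximal2[OF this, of N] assms(2) show thesis
    using that unfolding maximal_independent_set_def by blast
qed

lemma dominates_color_subgraph_iff:
  assumes "u \<in> verts G" "v \<in> verts G" "x \<in> L u" "x \<in> L v"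
  shows "u \<rightarrow>\<^bsub>color_subgraph G L x\<^esub> v \<longleftrightarrow> u \<rightarrow>\<^bsub>G\<^esub> v"
  using assms
  by (auto simp: color_subgraph_def induce_subgraph_def arcs_ends_def arc_to_ends_def)

lemma verts_color_subgraph: "verts (color_subgraph G L x) = {v \<in> verts G. x \<in> L v}"
  by (simp add: color_subgraph_def)

text \<open>Distinctness of \<open>vs\<close> makes the index of a vertex unique, so the description
  in \<open>vec_weight\<close> evaluates to it.\<close>

lemma vec_weight_nth:
  assumes "distinct vs" and "i < length vs"
  shows "vec_weight vs y (vs ! i) = y $ i"
proof -
  have "(THE j. j < length vs \<and> vs ! j = vs ! i) = i"
    using assms by (auto simp: nth_eq_iff_index_eq)
  then show ?thesis by (simp add: vec_weight_def)
qed

text \<open>Vertices colored \<open>x\<close> have \<open>x\<close> in their lists, hence lie in the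
  induced subgraph; an edge of it between two of them would be an edge of \<open>G\<close> whose
  ends share \<open>x\<close>.\<close>

lemma independent_set_color_class:
  assumes "C \<in> colorings G L w"
  shows "independent_set (color_subgraph G L x) {v \<in> verts G. x \<in> C v}"
proof -
  have "\<not> u \<rightarrow>\<^bsub>color_subgraph G L x\<^esub> v"
    if "u \<in> verts G" "v \<in> verts G" "x \<in> C u" "x \<in> C v" for u v
  proof -
    have "x \<in> L u" "x \<in> L v" and "\<not> u \<rightarrow>\<^bsub>G\<^esub> v"
      using assms that unfolding colorings_def by blast+
    then show ?thesis
      using that by (simp add: dominates_color_subgraph_iff)
  qed
  moreover have "{v \<in> verts G. x \<in> C v} \<subseteq> verts (color_subgraph G L x)"
    using assms by (auto simp: colorings_def verts_color_subgraph)
  ultimately show ?thesis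
    by (auto simp: independent_set_def)
qed

text \<open>List membership and disjointness along edges pass to subsets, and the vector equation of
  \<open>sub_colorings\<close> fixes the cardinalities.\<close>

lemma sub_coloring_of_max_coloring:
  assumes "distinct vs" and "set vs = verts G"
    and "weight_vec vs w \<le> w'"
    and "C' \<in> colorings G L (vec_weight vs w')"
    and "C \<in> sub_colorings vs G C' (w' - weight_vec vs w)"
  shows "C \<in> colorings G L w"
proof -
  \<comment> \<open>The order on vectors includes equality of dimensions, which determines the
    length of \<open>w'\<close>.\<close>
  have dim: "dim_vec w' = length vs"
    and le: "\<And>i. i < length vs \<Longrightarrow> w (vs ! i) \<le> w' $ i"
    using assms(3) by (auto simp: less_eq_vec_def weight_vec_def)
  have sub: "C v \<subseteq> C' v" if "v \<in> verts G" for v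
    using assms(5) that by (simp add: sub_colorings_def)
  have C': "C' v \<subseteq> L v" "card (C' v) = vec_weight vs w' v" if "v \<in> verts G" for v
    using assms(4) that by (simp_all add: colorings_def)
  have card: "card (C v) = w v" if v: "v \<in> verts G" for v
  proof -
    obtain i where i: "i < length vs" "v = vs ! i"
      using v assms(2) by (metis in_set_conv_nth)
    have "(card_vec vs C + (w' - weight_vec vs w)) $ i = card_vec vs C' $ i"
      using assms(5) by (simp add: sub_colorings_def)
    then have "card (C v) + (w' $ i - w v) = w' $ i"
      using i dim C'(2)[OF v] vec_weight_nth[OF assms(1) i(1)]
      by (simp add: card_vec_def weight_vec_def)
    \<comment> \<open>By \<open>le\<close> the truncated difference is exact, so the equation can be
      solved for \<open>card (C v)\<close>.\<close>
    then show ?thesis using le[OF i(1)] i(2) by simp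
  qed
  have "C v \<inter> C v' = {}" if "v \<in> verts G" "v' \<in> verts G" "v \<rightarrow>\<^bsub>G\<^esub> v'" for v v'
  proof -
    have "C' v \<inter> C' v' = {}"
      using assms(4) that by (simp add: colorings_def)
    then show ?thesis using sub that by blast
  qed
  moreover have "C \<in> extensional (verts G)"
    using assms(5) by (simp add: sub_colorings_def)
  ultimately show ?thesis
    using sub C'(1) card unfolding colorings_def by blast
qed

text \<open>Converse passage from independent sets to colorings: \<open>M x\<close> becomes the
  class of color \<open>x\<close>, so maximality of the classes is inherited from \<open>M\<close>,
  and the weight vector is the sum of their characteristic vectors.\<close>

lemma coloring_of_independent_sets:
  fixes G :: "('a, 'b) pre_digraph" and vs :: "'a list"
  assumes "distinct vs" and "set vs = verts G"
    and "finite (all_colors G L)"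
    and M: "\<And>x. x \<in> all_colors G L \<Longrightarrow> maximal_independent_set (color_subgraph G L x) (M x)"
  defines "C \<equiv> \<lambda>v \<in> verts G. {x \<in> all_colors G L. v \<in> M x}"
  shows "card_vec vs C \<in> W_max vs G L"
    and "C \<in> max_colorings vs G L (vec_weight vs (card_vec vs C))"
proof -
  have C_eq: "C v = {x \<in> all_colors G L. v \<in> M x}" if "v \<in> verts G" for v
    using that by (simp add: C_def)
  have M_sub: "v \<in> verts G \<and> x \<in> L v" if "x \<in> all_colors G L" "v \<in> M x" for v x
    using M[OF that(1)] that(2)
    by (auto simp: maximal_independent_set_def independent_set_def verts_color_subgraph)
  have nth: "vs ! i \<in> verts G" if "i < length vs" for i
    using that assms(2) by (metis nth_mem)
  have mis: "char_vec vs (M x) \<in> MIS_vec vs (color_subgraph G L x)"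
    if "x \<in> all_colors G L" for x
    using M[OF that] by (auto simp: MIS_vec_def)
  have "card_vec vs C =
      finsum_vec TYPE(nat) (length vs) (\<lambda>x. char_vec vs (M x)) (all_colors G L)"
  proof (rule eq_vecI)
    have cl: "(\<lambda>x. char_vec vs (M x)) \<in> all_colors G L \<rightarrow> carrier_vec (length vs)"
      by (auto simp: char_vec_def)
    show "dim_vec (card_vec vs C) =
        dim_vec (finsum_vec TYPE(nat) (length vs) (\<lambda>x. char_vec vs (M x)) (all_colors G L))"
      using finsum_vec_closed[OF cl] by (auto simp: card_vec_def)
    fix i
    assume "i < dim_vec
      (finsum_vec TYPE(nat) (length vs) (\<lambda>x. char_vec vs (M x)) (all_colors G L))"
    then have i: "i < length vs"
      using finsum_vec_closed[OF cl] by auto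
    \<comment> \<open>Double counting: coordinate \<open>i\<close> of the sum counts the colors
      \<open>x\<close> whose set \<open>M x\<close> contains \<open>vs ! i\<close>.\<close>
    have "finsum_vec TYPE(nat) (length vs) (\<lambda>x. char_vec vs (M x)) (all_colors G L) $ i =
        (\<Sum>x\<in>all_colors G L. if vs ! i \<in> M x then 1 else 0)"
      using index_finsum_vec[OF assms(3) i cl] i by (simp add: char_vec_def)
    also have "\<dots> = card (C (vs ! i))"
      using sum.inter_filter[OF assms(3), of "\<lambda>_. 1 :: nat" "\<lambda>x. vs ! i \<in> M x"]
      by (simp add: C_eq[OF nth[OF i]])
    finally show "card_vec vs C $ i =
        finsum_vec TYPE(nat) (length vs) (\<lambda>x. char_vec vs (M x)) (all_colors G L) $ i"
      using i by (simp add: card_vec_def)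
  qed
  then show "card_vec vs C \<in> W_max vs G L"
    using mis unfolding W_max_def by blast
  have card: "card (C v) = vec_weight vs (card_vec vs C) v" if v: "v \<in> verts G" for v
  proof -
    obtain i where i: "i < length vs" "v = vs ! i"
      using v assms(2) by (metis in_set_conv_nth)
    then show ?thesis
      using vec_weight_nth[OF assms(1) i(1)] by (simp add: card_vec_def)
  qed
  have disj: "C v \<inter> C v' = {}"
    if v: "v \<in> verts G" "v' \<in> verts G" and e: "v \<rightarrow>\<^bsub>G\<^esub> v'" for v v'
  proof (rule ccontr)
    assume "C v \<inter> C v' \<noteq> {}"
    then obtain x where x: "x \<in> all_colors G L" "v \<in> M x" "v' \<in> M x"
      using v by (auto simp: C_eq)
    then have "v \<rightarrow>\<^bsub>color_subgraph G L x\<^esub> v'"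
      using dominates_color_subgraph_iff[of v G v' x L] M_sub e by blast
    then show False
      using M[OF x(1)] x(2,3)
      by (auto simp: maximal_independent_set_def independent_set_def)
  qed
  have "C v \<subseteq> L v" if "v \<in> verts G" for v
    using M_sub by (auto simp: C_eq[OF that])
  then have "C \<in> colorings G L (vec_weight vs (card_vec vs C))"
    using card disj by (simp add: colorings_def C_def)
  moreover have "card_vec vs (color_part G C x) = char_vec vs (M x)"
    if "x \<in> all_colors G L" for x
    using that nth by (auto simp: card_vec_def char_vec_def color_part_def C_eq)
  ultimately show "C \<in> max_colorings vs G L (vec_weight vs (card_vec vs C))"
    using mis by (simp add: max_colorings_def)
qed

theorem theorem3p1:
  fixes G :: "('a, 'b) pre_digraph" and vs :: "'a list"
    and L :: "'a \<Rightarrow> nat set" and w :: "'a \<Rightarrow> nat"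
  assumes "graph G"
    and "distinct vs" and "set vs = verts G"
    and "is_list G L"
    and "colorable G L w"
  shows "colorings G L w =
    (\<Union>w' \<in> {w' \<in> W_max vs G L. weight_vec vs w \<le> w'}.
      \<Union>C' \<in> max_colorings vs G L (vec_weight vs w').
        sub_colorings vs G C' (w' - weight_vec vs w))"
    (is "_ = ?R")
proof (intro equalityI subsetI)
  fix C
  assume "C \<in> ?R"
  then show "C \<in> colorings G L w"
    using sub_coloring_of_max_coloring[OF assms(2,3)] by (auto simp: max_colorings_def)
next
  fix C
  assume C: "C \<in> colorings G L w"
  have fin: "finite (verts G)"
    using assms(3) by (metis finite_set)
  have fin_colors: "finite (all_colors G L)"
    using fin assms(4) by (auto simp: all_colors_def is_list_def)
  \<comment> \<open>This covers colors in no list too: their subgraph and color class are empty, and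
    the empty set serves as \<open>M\<close>.\<close>
  have "\<exists>M. maximal_independent_set (color_subgraph G L x) M \<and> {v \<in> verts G. x \<in> C v} \<subseteq> M" for x
  proof -
    have "finite (verts (color_subgraph G L x))"
      using fin by (simp add: verts_color_subgraph)
    then show ?thesis
      using independent_set_extend_maximal[OF _ independent_set_color_class[OF C, of x]] by blast
  qed
  then obtain M where M: "\<And>x. maximal_independent_set (color_subgraph G L x) (M x)"
    and CM: "\<And>x. {v \<in> verts G. x \<in> C v} \<subseteq> M x"
    by metis
  define C' where "C' = (\<lambda>v \<in> verts G. {x \<in> all_colors G L. v \<in> M x})"
  note C'_max = coloring_of_independent_sets[OF assms(2,3) fin_colors M, folded C'_def]
  have CL: "C v \<subseteq> L v" "card (C v) = w v" if "v \<in> verts G" for v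
    using C that by (simp_all add: colorings_def)
  have sub: "C v \<subseteq> C' v" if "v \<in> verts G" for v
    using CL(1) CM that by (auto simp: C'_def all_colors_def)
  have le: "w (vs ! i) \<le> card (C' (vs ! i))" if "i < length vs" for i
  proof -
    have v: "vs ! i \<in> verts G"
      using that assms(3) by (metis nth_mem)
    \<comment> \<open>Monotonicity of \<open>card\<close> needs a finite superset, since infinite
      sets have cardinality 0.\<close>
    have "finite (C' (vs ! i))"
      using v fin_colors by (simp add: C'_def)
    then show ?thesis
      using card_mono[OF _ sub[OF v]] CL(2)[OF v] by simp
  qed
  \<comment> \<open>The witness for \<open>w'\<close> in the union is
    \<open>card_vec vs C'\<close>.\<close>
  have "weight_vec vs w \<le> card_vec vs C'"
    using le by (simp add: less_eq_vec_def weight_vec_def card_vec_def)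
  moreover have "C \<in> sub_colorings vs G C' (card_vec vs C' - weight_vec vs w)"
  proof -
    have "card_vec vs C = weight_vec vs w"
      using CL(2) nth_mem[of _ vs] assms(3)
      by (intro eq_vecI) (simp_all add: card_vec_def weight_vec_def)
    \<comment> \<open>The coordinatewise bound \<open>le\<close> prevents truncation in the
      difference.\<close>
    moreover have "weight_vec vs w + (card_vec vs C' - weight_vec vs w) = card_vec vs C'"
      using le by (auto simp: card_vec_def weight_vec_def)
    ultimately show ?thesis
      using C sub by (simp add: sub_colorings_def colorings_def)
  qed
  ultimately show "C \<in> ?R"
    using C'_max by blast
qed

end
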